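(* Let $n \ge 1$ and $m_1,\dots,m_n \ge 1$ be integers. The set of $n$-player games of size $m_1\times m_2\times\cdots\times m_n$ that have a unique correlated equilibrium is an open subset of the set of all games of size $m_1\times\cdots\times m_n$. Furthermore, if a game $G$ of size $m_1\times\cdots\times m_n$ has a unique correlated equilibrium $\sigma$, then there is a neighborhood of $G$, in the set of games of that size, such that every game in this neighborhood has a unique correlated equilibrium and this correlated equilibrium has the same support as $\sigma$.
   Context: A finite $n$-player game has player set $I=\{1,\dots,n\}$, finite nonempty pure strategy sets $S^i$ ($i\in I$), $S=\times_{i\in I}S^i$, $S^{-i}=\times_{j\ne i}S^j$, and utility functions $U^i:S\to\mathbb{R}$. The game has size $m_1\times\cdots\times m_n$ if $|S^i|=m_i$ for all $i$. Fixing the strategy sets, such a game is identified with its payoffs, i.e. with a point of $(\mathbb{R}^{m_1m_2\cdots m_n})^n$; open sets and neighborhoods refer to the usual topology of this space. A correlated equilibrium is a probability distribution $\mu$ on $S$ such that for all $i\in I$ and all $s^i,t^i\in S^i$, $$\sum_{s^{-i}\in S^{-i}}\mu(s^i,s^{-i})\,[U^i(s^i,s^{-i})-U^i(t^i,s^{-i})]\ge 0 .$$ The support of $\mu$ is $\{s\in S:\mu(s)>0\}$. *)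

theory Defs
  imports "HOL-Probability.Probability"
begin

text \<open>
  Players are \<open>{1..n}\<close>; player \<open>i\<close> has strategy set \<open>S i\<close>.  A game with these strategy sets is
  its payoff family \<open>U\<close>, where \<open>U i s\<close> is the utility of player \<open>i\<close> at the profile \<open>s\<close>.
  Profiles and payoffs are extensional functions, so that equality of games and of profiles
  is not affected by values outside the intended domains.
\<close>

definition profiles :: "nat \<Rightarrow> (nat \<Rightarrow> 's set) \<Rightarrow> (nat \<Rightarrow> 's) set"
  where "profiles n S = (\<Pi>\<^sub>E i\<in>{1..n}. S i)"

definition opponent_profiles :: "nat \<Rightarrow> (nat \<Rightarrow> 's set) \<Rightarrow> nat \<Rightarrow> (nat \<Rightarrow> 's) set"
  where "opponent_profiles n S i = (\<Pi>\<^sub>E j\<in>{1..n} - {i}. S j)"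

definition games :: "nat \<Rightarrow> (nat \<Rightarrow> 's set) \<Rightarrow> (nat \<Rightarrow> (nat \<Rightarrow> 's) \<Rightarrow> real) set"
  where "games n S = (\<Pi>\<^sub>E i\<in>{1..n}. \<Pi>\<^sub>E s\<in>profiles n S. UNIV)"

definition game_topology ::
    "nat \<Rightarrow> (nat \<Rightarrow> 's set) \<Rightarrow> (nat \<Rightarrow> (nat \<Rightarrow> 's) \<Rightarrow> real) topology"
  where "game_topology n S =
    product_topology (\<lambda>i. product_topology (\<lambda>s. euclideanreal) (profiles n S)) {1..n}"

lemma topspace_game_topology: "topspace (game_topology n S) = games n S"
  by (simp add: game_topology_def games_def)

text \<open>
  For \<open>r\<close> in \<open>opponent_profiles n S i\<close>, the update \<open>r(i := a)\<close> is the profile in which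
  player \<open>i\<close> plays \<open>a\<close> and the others play \<open>r\<close>.
\<close>

definition correlated_equilibrium ::
    "nat \<Rightarrow> (nat \<Rightarrow> 's set) \<Rightarrow> (nat \<Rightarrow> (nat \<Rightarrow> 's) \<Rightarrow> real) \<Rightarrow> (nat \<Rightarrow> 's) pmf \<Rightarrow> bool"
  where "correlated_equilibrium n S U \<mu> \<longleftrightarrow>
    set_pmf \<mu> \<subseteq> profiles n S \<and>
    (\<forall>i\<in>{1..n}. \<forall>a\<in>S i. \<forall>b\<in>S i.
      (\<Sum>r\<in>opponent_profiles n S i. pmf \<mu> (r(i := a)) * (U i (r(i := a)) - U i (r(i := b)))) \<ge> 0)"

definition unique_correlated_equilibrium ::
    "nat \<Rightarrow> (nat \<Rightarrow> 's set) \<Rightarrow> (nat \<Rightarrow> (nat \<Rightarrow> 's) \<Rightarrow> real) \<Rightarrow> (nat \<Rightarrow> 's) pmf \<Rightarrow> bool"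
  where "unique_correlated_equilibrium n S U \<sigma> \<longleftrightarrow>
    correlated_equilibrium n S U \<sigma> \<and> (\<forall>\<mu>. correlated_equilibrium n S U \<mu> \<longrightarrow> \<mu> = \<sigma>)"

end

theory Submission
  imports Defs
begin

text \<open>
  Let \<open>G\<close> have the unique correlated equilibrium \<open>\<sigma>\<close>, let \<open>K\<close> be the set of incentive constraints
  binding at \<open>\<sigma>\<close> and \<open>Z\<close> the set of profiles outside the support.  Uniqueness says that the only
  vector \<open>x\<close> with sum \<open>0\<close>, \<open>x \<ge> 0\<close> on \<open>Z\<close> and nonnegative incentive sums on \<open>K\<close> is \<open>0\<close>; by
  compactness this persists for games \<open>H\<close> near \<open>G\<close>.  By Farkas' lemma it provides weights \<open>y\<close> that
  are positive exactly on \<open>K\<close>, such that the \<open>y\<close>-combination of the incentive constraints of \<open>H\<close> is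
  a constant \<open>c\<close> off \<open>Z\<close> and smaller than \<open>c\<close> on \<open>Z\<close>.

  If \<open>c = 0\<close>, complementary slackness forces every equilibrium of \<open>H\<close> to vanish on \<open>Z\<close> and to make
  all constraints in \<open>K\<close> binding, so the difference of two equilibria is \<open>0\<close>.  To see that \<open>c = 0\<close>, use
  the Hart-Schmeidler product distribution: if each player randomises according to a stationary
  distribution of the transition rates \<open>y\<close>, the \<open>y\<close>-combination has expectation \<open>0\<close>.  For \<open>G\<close> itself
  \<open>c = 0\<close> is seen by evaluating at \<open>\<sigma>\<close>, so that the stationary product is supported off \<open>Z\<close>.  Its
  support is a rectangle closed under the transitions in \<open>K\<close>, hence it also carries a stationary
  product for the weights of \<open>H\<close>, whose zero pattern is the same.

  An equilibrium of \<open>H\<close> exists by the same product construction and Farkas' lemma, and by compactness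
  it charges every profile in the support of \<open>\<sigma>\<close> if \<open>H\<close> is near \<open>G\<close>.
\<close>

section \<open>Farkas' lemma and stationary distributions\<close>

text \<open>
  Bartl's algebraic proof: if the constraint \<open>f k\<close> cannot be dropped, some \<open>x0\<close> violates only it and
  \<open>g\<close>; projecting along \<open>x0\<close> onto the kernel of \<open>f k\<close> reduces to the remaining constraints.
\<close>

lemma farkas:
  fixes f :: "'j \<Rightarrow> 'a \<Rightarrow> real" and g :: "'a \<Rightarrow> real"
  assumes "finite J" "finite A"
    and "\<And>x. (\<And>j. j \<in> J \<Longrightarrow> 0 \<le> (\<Sum>s\<in>A. f j s * x s)) \<Longrightarrow> 0 \<le> (\<Sum>s\<in>A. g s * x s)"
  shows "\<exists>l. (\<forall>j\<in>J. 0 \<le> l j) \<and> (\<forall>s\<in>A. g s = (\<Sum>j\<in>J. l j * f j s))"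
  using assms(1,3)
proof (induction J arbitrary: f g rule: finite_induct)
  case empty
  \<comment> \<open>Without constraints every vector is admissible, so \<open>g\<close> can be
    tested against \<open>- g\<close>.\<close>
  have "0 \<le> (\<Sum>s\<in>A. g s * - g s)"
    by (rule empty.prems) simp
  then have "(\<Sum>s\<in>A. g s * g s) \<le> 0"
    by (simp add: sum_negf)
  moreover have "(\<Sum>s\<in>A. g s * g s) \<ge> 0"
    by (simp add: sum_nonneg)
  ultimately have "\<forall>s\<in>A. g s * g s = 0"
    using \<open>finite A\<close> by (subst sum_nonneg_eq_0_iff [symmetric]) auto
  then show ?case
    by auto
next
  case (insert k J)
  define ev where "ev h x = (\<Sum>s\<in>A. h s * x s)" for h x :: "'a \<Rightarrow> real"
  have prems: "0 \<le> ev g x" if "\<And>j. j \<in> insert k J \<Longrightarrow> 0 \<le> ev (f j) x" for x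
    using insert.prems that unfolding ev_def by blast
  have ev_add: "ev h (\<lambda>s. x s + c * z s) = ev h x + c * ev h z" for h x z c
    by (simp add: ev_def algebra_simps sum.distrib sum_distrib_left)
  show ?case
  proof (cases "\<forall>x. (\<forall>j\<in>J. 0 \<le> ev (f j) x) \<longrightarrow> 0 \<le> ev g x")
    case True
    then obtain l where "\<forall>j\<in>J. 0 \<le> l j" "\<forall>s\<in>A. g s = (\<Sum>j\<in>J. l j * f j s)"
      using insert.IH [of f g] unfolding ev_def by blast
    then show ?thesis
      using insert.hyps
      by (intro exI [of _ "\<lambda>j. if j = k then 0 else l j"]) (auto intro!: sum.cong)
  next
    case False
    then obtain x0 where x0: "\<forall>j\<in>J. 0 \<le> ev (f j) x0" "ev g x0 < 0"
      by (auto simp: not_le)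
    with prems [of x0] have neg: "ev (f k) x0 < 0"
      by force
    \<comment> \<open>Chosen so that \<open>h - c h * f k\<close> vanishes at \<open>x0\<close>;
      evaluating it at \<open>x\<close> is the same as evaluating \<open>h\<close> at the projection
      of \<open>x\<close>.\<close>
    define c where "c h = ev h x0 / ev (f k) x0" for h
    have ev_proj: "ev (\<lambda>s. h s - c h * f k s) x = ev h (\<lambda>s. x s + (- ev (f k) x / ev (f k) x0) * x0 s)"
      for h x
    proof -
      have "ev (\<lambda>s. h s - c h * f k s) x = ev h x - c h * ev (f k) x"
        by (simp add: ev_def algebra_simps sum_subtractf sum_distrib_left)
      then show ?thesis
        unfolding ev_add by (simp add: c_def)
    qed
    have "0 \<le> ev (\<lambda>s. g s - c g * f k s) x"
      if "\<And>j. j \<in> J \<Longrightarrow> 0 \<le> ev (\<lambda>s. f j s - c (f j) * f k s) x" for x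
      unfolding ev_proj
    proof (rule prems)
      fix j assume "j \<in> insert k J"
      then show "0 \<le> ev (f j) (\<lambda>s. x s + (- ev (f k) x / ev (f k) x0) * x0 s)"
        using that [of j] neg unfolding ev_proj ev_add by (cases "j = k") auto
    qed
    then obtain l where l: "\<forall>j\<in>J. 0 \<le> l j"
      "\<forall>s\<in>A. g s - c g * f k s = (\<Sum>j\<in>J. l j * (f j s - c (f j) * f k s))"
      using insert.IH [of "\<lambda>j s. f j s - c (f j) * f k s" "\<lambda>s. g s - c g * f k s"]
      unfolding ev_def by blast
    \<comment> \<open>The total coefficient of \<open>f k\<close> after undoing the projection. Its
      sign follows since \<open>g\<close> and \<open>f k\<close> are negative at \<open>x0\<close>,
      while every \<open>f j\<close> is nonnegative there.\<close>
    define m where "m = c g - (\<Sum>j\<in>J. l j * c (f j))"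
    have "c g \<ge> 0"
      using x0 neg by (simp add: c_def divide_nonpos_neg)
    moreover have "(\<Sum>j\<in>J. l j * c (f j)) \<le> 0"
      using x0 neg l by (intro sum_nonpos mult_nonneg_nonpos) (auto simp: c_def divide_nonneg_neg)
    ultimately have "m \<ge> 0"
      by (simp add: m_def)
    moreover have "g s = m * f k s + (\<Sum>j\<in>J. l j * f j s)" if "s \<in> A" for s
      using l(2) that by (simp add: m_def algebra_simps sum_subtractf sum_distrib_left)
    ultimately show ?thesis
      using insert.hyps l(1)
      by (intro exI [of _ "\<lambda>j. if j = k then m else l j"]) (auto intro!: sum.cong)
  qed
qed

text \<open>The sign conditions on \<open>Z\<close> are constraints given by unit vectors, so
  \<open>farkas\<close> applies with the index set \<open>J <+> Z\<close>. Their multipliers are the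
  slack on \<open>Z\<close>.\<close>

lemma farkas_signed:
  fixes f :: "'j \<Rightarrow> 'a \<Rightarrow> real" and g :: "'a \<Rightarrow> real"
  assumes "finite J" "finite A" "Z \<subseteq> A"
    and imp: "\<And>x. \<lbrakk>\<And>j. j \<in> J \<Longrightarrow> 0 \<le> (\<Sum>s\<in>A. f j s * x s); \<And>s. s \<in> Z \<Longrightarrow> 0 \<le> x s\<rbrakk>
           \<Longrightarrow> 0 \<le> (\<Sum>s\<in>A. g s * x s)"
  obtains l where "\<And>j. j \<in> J \<Longrightarrow> 0 \<le> l j" "\<And>s. s \<in> Z \<Longrightarrow> (\<Sum>j\<in>J. l j * f j s) \<le> g s"
    "\<And>s. s \<in> A - Z \<Longrightarrow> (\<Sum>j\<in>J. l j * f j s) = g s"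
proof -
  define F where "F q s = (case q of Inl j \<Rightarrow> f j s | Inr t \<Rightarrow> of_bool (s = t))"
    for q :: "'j + 'a" and s
  have finZ: "finite Z"
    using assms finite_subset by blast
  have "\<exists>l. (\<forall>q\<in>J <+> Z. 0 \<le> l q) \<and> (\<forall>s\<in>A. g s = (\<Sum>q\<in>J <+> Z. l q * F q s))"
  proof (rule farkas)
    fix x assume x: "\<And>q. q \<in> J <+> Z \<Longrightarrow> 0 \<le> (\<Sum>s\<in>A. F q s * x s)"
    show "0 \<le> (\<Sum>s\<in>A. g s * x s)"
    proof (rule imp)
      show "0 \<le> (\<Sum>s\<in>A. f j s * x s)" if "j \<in> J" for j
        using x [OF InlI [OF that]] by (simp add: F_def)
      show "0 \<le> x s" if "s \<in> Z" for s
        using x [OF InrI [OF that]] that assms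
        by (auto simp: F_def of_bool_def mult_delta_left split: if_splits)
    qed
  qed (use assms finZ in auto)
  then obtain l where l: "\<forall>q\<in>J <+> Z. 0 \<le> l q" "\<forall>s\<in>A. g s = (\<Sum>q\<in>J <+> Z. l q * F q s)"
    by blast
  have eq: "g s = (\<Sum>j\<in>J. l (Inl j) * f j s) + (if s \<in> Z then l (Inr s) else 0)" if "s \<in> A" for s
    using l(2) that \<open>finite J\<close> finZ
    by (simp add: sum.Plus F_def of_bool_def mult_delta_right)
  show ?thesis
    by (rule that [of "\<lambda>j. l (Inl j)"]) (use l(1) eq \<open>Z \<subseteq> A\<close> in \<open>auto simp: subset_eq\<close>)
qed

text \<open>Net inflows sum to zero over \<open>R\<close>, so it suffices to find a nonzero
  \<open>x \<ge> 0\<close> with nonnegative net inflow everywhere. Otherwise Farkas' lemma yields a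
  function \<open>l\<close> with drift at most \<open>-1\<close> at every state, which is impossible
  at a minimiser of \<open>l\<close>.\<close>

lemma stationary_exists:
  fixes y :: "'a \<Rightarrow> 'a \<Rightarrow> real"
  assumes "finite R" "R \<noteq> {}" and y: "\<And>a b. a \<in> R \<Longrightarrow> b \<in> R \<Longrightarrow> 0 \<le> y a b"
  obtains p where "\<And>a. a \<in> R \<Longrightarrow> 0 \<le> p a" "(\<Sum>a\<in>R. p a) = 1"
    "\<And>b. b \<in> R \<Longrightarrow> (\<Sum>a\<in>R. p a * y a b) = p b * (\<Sum>a\<in>R. y b a)"
proof -
  \<comment> \<open>The transposed generator of the chain with rates \<open>y\<close>: the sum of
    \<open>Q b a * x a\<close> over \<open>a\<close> is the net inflow into
    \<open>b\<close>.\<close>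
  define Q where "Q b a = y a b - (if a = b then (\<Sum>c\<in>R. y a c) else 0)" for a b
  have Qx: "(\<Sum>a\<in>R. Q b a * x a) = (\<Sum>a\<in>R. x a * y a b) - x b * (\<Sum>a\<in>R. y b a)"
    if "b \<in> R" for b x
    using that \<open>finite R\<close>
    by (simp add: Q_def left_diff_distrib sum_subtractf mult_delta_left, simp add: mult.commute)
  have "\<exists>x. (\<forall>b\<in>R. 0 \<le> (\<Sum>a\<in>R. Q b a * x a)) \<and> (\<forall>a\<in>R. 0 \<le> x a) \<and> 0 < (\<Sum>a\<in>R. x a)"
  proof (rule ccontr)
    assume neg: "\<nexists>x. (\<forall>b\<in>R. 0 \<le> (\<Sum>a\<in>R. Q b a * x a)) \<and> (\<forall>a\<in>R. 0 \<le> x a) \<and> 0 < (\<Sum>a\<in>R. x a)"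
    obtain l where l: "\<And>b. b \<in> R \<Longrightarrow> 0 \<le> l b" "\<And>a. a \<in> R \<Longrightarrow> (\<Sum>b\<in>R. l b * Q b a) \<le> - 1"
    proof (rule farkas_signed [of R R R Q "\<lambda>_. -1"])
      fix x assume "\<And>b. b \<in> R \<Longrightarrow> 0 \<le> (\<Sum>a\<in>R. Q b a * x a)" "\<And>a. a \<in> R \<Longrightarrow> 0 \<le> x a"
      then show "0 \<le> (\<Sum>a\<in>R. - 1 * x a)"
        using neg by (force simp: sum_negf not_less)
    qed (use assms in auto)
    \<comment> \<open>From a minimiser of \<open>l\<close> every transition leads to a value at
      least as large, so the drift there is nonnegative.\<close>
    obtain a where a: "a \<in> R" "\<And>b. b \<in> R \<Longrightarrow> l a \<le> l b"
      using ex_is_arg_min_if_finite [OF assms(1,2), of l] by (force simp: is_arg_min_linorder)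
    have "(\<Sum>b\<in>R. l b * Q b a) = (\<Sum>b\<in>R. y a b * (l b - l a))"
      using a(1) \<open>finite R\<close>
      by (simp add: Q_def right_diff_distrib sum_subtractf mult_delta_right sum_distrib_left
               mult.commute)
    also have "\<dots> \<ge> 0"
      using a y by (intro sum_nonneg) auto
    finally show False
      using l(2) [OF a(1)] by simp
  qed
  then obtain x where x: "\<And>b. b \<in> R \<Longrightarrow> 0 \<le> (\<Sum>a\<in>R. Q b a * x a)" "\<And>a. a \<in> R \<Longrightarrow> 0 \<le> x a"
    "0 < (\<Sum>a\<in>R. x a)"
    by blast
  have "(\<Sum>b\<in>R. \<Sum>a\<in>R. Q b a * x a) = (\<Sum>b\<in>R. \<Sum>a\<in>R. x a * y a b) - (\<Sum>b\<in>R. x b * (\<Sum>a\<in>R. y b a))"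
    by (simp add: Qx sum_subtractf)
  also have "\<dots> = 0"
    by (subst sum.swap) (simp add: sum_distrib_left)
  finally have "\<forall>b\<in>R. (\<Sum>a\<in>R. Q b a * x a) = 0"
    using sum_nonneg_eq_0_iff [OF \<open>finite R\<close> x(1)] by simp
  then have st: "(\<Sum>a\<in>R. x a * y a b) = x b * (\<Sum>a\<in>R. y b a)" if "b \<in> R" for b
    using Qx that by simp
  define t where "t = (\<Sum>a\<in>R. x a)"
  show ?thesis
  proof (rule that [of "\<lambda>a. x a / t"])
    show "(\<Sum>a\<in>R. x a / t * y a b) = x b / t * (\<Sum>a\<in>R. y b a)" if "b \<in> R" for b
      using st [OF that] by (simp flip: sum_divide_distrib)
    show "(\<Sum>a\<in>R. x a / t) = 1"
      using x(3) by (simp add: t_def flip: sum_divide_distrib)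
  qed (use x t_def in auto)
qed

section \<open>Incentive constraints as linear functionals\<close>

text \<open>Triples with equal strategies are included; their constraint is identically
  zero.\<close>

definition deviations :: "nat \<Rightarrow> (nat \<Rightarrow> 's set) \<Rightarrow> (nat \<times> 's \<times> 's) set"
  where "deviations n S = (SIGMA i:{1..n}. S i \<times> S i)"

text \<open>The coefficient of profile \<open>s\<close> in a constraint. The case distinction on
  \<open>s i\<close> lets the constraint be summed over all profiles instead of opponent
  profiles.\<close>

definition incentive ::
    "(nat \<Rightarrow> (nat \<Rightarrow> 's) \<Rightarrow> real) \<Rightarrow> nat \<times> 's \<times> 's \<Rightarrow> (nat \<Rightarrow> 's) \<Rightarrow> real"
  where "incentive U = (\<lambda>(i, a, b) s. if s i = a then U i s - U i (s(i := b)) else 0)"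

text \<open>Defined for arbitrary real vectors, since it is also applied to directions and to
  differences of distributions.\<close>

definition incentive_sum ::
    "nat \<Rightarrow> (nat \<Rightarrow> 's set) \<Rightarrow> (nat \<Rightarrow> (nat \<Rightarrow> 's) \<Rightarrow> real) \<Rightarrow> nat \<times> 's \<times> 's \<Rightarrow>
      ((nat \<Rightarrow> 's) \<Rightarrow> real) \<Rightarrow> real"
  where "incentive_sum n S U k x = (\<Sum>s\<in>profiles n S. incentive U k s * x s)"

lemma finite_profiles: "\<forall>i\<in>{1..n}. finite (S i) \<Longrightarrow> finite (profiles n S)"
  by (auto simp: profiles_def intro: finite_PiE)

lemma finite_deviations: "\<forall>i\<in>{1..n}. finite (S i) \<Longrightarrow> finite (deviations n S)"
  by (auto simp: deviations_def)

text \<open>Exchanging the sums reads a combination of constraints as one functional on profiles;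
  the duality arguments compare these two readings.\<close>

lemma weighted_incentive_sum:
  "(\<Sum>k\<in>K. y k * incentive_sum n S U k x) =
    (\<Sum>s\<in>profiles n S. (\<Sum>k\<in>K. y k * incentive U k s) * x s)"
  unfolding incentive_sum_def sum_distrib_left sum_distrib_right
  by (subst sum.swap) (simp add: mult.assoc)

lemma incentive_sum_add_scaled:
  "incentive_sum n S U k (\<lambda>s. x s + e * z s) = incentive_sum n S U k x + e * incentive_sum n S U k z"
  by (simp add: incentive_sum_def algebra_simps sum.distrib sum_distrib_left)

lemma incentive_sum_cong:
  "(\<And>s. s \<in> profiles n S \<Longrightarrow> x s = z s) \<Longrightarrow> incentive_sum n S U k x = incentive_sum n S U k z"
  by (simp add: incentive_sum_def)

lemma incentive_sum_opponents:
  assumes fin: "\<forall>i\<in>{1..n}. finite (S i)" and "i \<in> {1..n}" "a \<in> S i"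
  shows "incentive_sum n S U (i, a, b) x =
    (\<Sum>r\<in>opponent_profiles n S i. x (r(i := a)) * (U i (r(i := a)) - U i (r(i := b))))"
proof -
  have "incentive_sum n S U (i, a, b) x =
      (\<Sum>s\<in>profiles n S. if s i = a then x s * (U i s - U i (s(i := b))) else 0)"
    unfolding incentive_sum_def incentive_def by (intro sum.cong) auto
  also have "\<dots> = (\<Sum>s | s \<in> profiles n S \<and> s i = a. x s * (U i s - U i (s(i := b))))"
    using finite_profiles [OF fin] by (simp add: sum.inter_filter)
  also have "\<dots> = (\<Sum>r\<in>opponent_profiles n S i. x (r(i := a)) * (U i (r(i := a)) - U i (r(i := b))))"
    using assms
    \<comment> \<open>Setting coordinate \<open>i\<close> to \<open>undefined\<close> removes player
      \<open>i\<close> from an extensional profile.\<close>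
    by (intro sum.reindex_bij_witness [of _ "\<lambda>r. r(i := a)" "\<lambda>s. s(i := undefined)"])
      (auto simp: profiles_def opponent_profiles_def PiE_iff extensional_def)
  finally show ?thesis .
qed

lemma correlated_equilibrium_iff:
  assumes "\<forall>i\<in>{1..n}. finite (S i)"
  shows "correlated_equilibrium n S U \<mu> \<longleftrightarrow>
    set_pmf \<mu> \<subseteq> profiles n S \<and> (\<forall>k\<in>deviations n S. 0 \<le> incentive_sum n S U k (pmf \<mu>))"
  using assms
  by (simp add: correlated_equilibrium_def deviations_def incentive_sum_opponents Ball_def, blast)

lemma correlated_equilibrium_of_vector:
  assumes fin: "\<forall>i\<in>{1..n}. finite (S i)"
    and nonneg: "\<And>s. s \<in> profiles n S \<Longrightarrow> 0 \<le> x s" and sum1: "(\<Sum>s\<in>profiles n S. x s) = 1"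
    and inc: "\<And>k. k \<in> deviations n S \<Longrightarrow> 0 \<le> incentive_sum n S U k x"
  obtains \<mu> where "correlated_equilibrium n S U \<mu>" "\<And>s. s \<in> profiles n S \<Longrightarrow> pmf \<mu> s = x s"
proof -
  \<comment> \<open>The values of \<open>x\<close> outside the profiles are arbitrary, so they are
    replaced by \<open>0\<close>.\<close>
  define f where "f s = (if s \<in> profiles n S then x s else 0)" for s
  have f0: "0 \<le> f s" for s
    by (simp add: f_def nonneg)
  have "(\<integral>\<^sup>+ s. ennreal (f s) \<partial>count_space UNIV) = (\<Sum>s\<in>profiles n S. ennreal (f s))"
    by (rule nn_integral_count_space') (auto simp: f_def finite_profiles [OF fin])
  also have "\<dots> = ennreal (\<Sum>s\<in>profiles n S. f s)"
    by (rule sum_ennreal) (rule f0)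
  also have "\<dots> = 1"
    using sum1 by (simp add: f_def)
  finally have f1: "(\<integral>\<^sup>+ s. ennreal (f s) \<partial>count_space UNIV) = 1" .
  have pmf: "pmf (embed_pmf f) s = f s" for s
    by (rule pmf_embed_pmf [OF f0 f1])
  have "incentive_sum n S U k (pmf (embed_pmf f)) = incentive_sum n S U k x" for k
    unfolding incentive_sum_def by (intro sum.cong) (auto simp: pmf f_def)
  then show ?thesis
    by (intro that [of "embed_pmf f"])
      (auto simp: correlated_equilibrium_iff [OF fin] inc pmf set_pmf_eq f_def split: if_splits)
qed

lemma sum_pmf_profiles:
  assumes "\<forall>i\<in>{1..n}. finite (S i)" "set_pmf \<mu> \<subseteq> profiles n S"
  shows "(\<Sum>s\<in>profiles n S. pmf \<mu> s) = 1"
  using assms by (simp add: sum_pmf_eq_1 finite_profiles)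

section \<open>Hart-Schmeidler products and existence of equilibria\<close>

text \<open>Fix a player \<open>i\<close> and the opponents' play \<open>r\<close>. The payoff
  \<open>U i (r(i := b))\<close> occurs with the flow out of \<open>b\<close> minus the flow into
  \<open>b\<close>, and these agree by stationarity, whatever \<open>U\<close> is.\<close>

lemma stationary_product:
  fixes p :: "nat \<Rightarrow> 's \<Rightarrow> real"
  assumes fin: "\<forall>i\<in>{1..n}. finite (S i)"
    and st: "\<And>i b. \<lbrakk>i \<in> {1..n}; b \<in> S i\<rbrakk> \<Longrightarrow>
      (\<Sum>a\<in>S i. p i a * y (i, a, b)) = p i b * (\<Sum>a\<in>S i. y (i, b, a))"
  shows "(\<Sum>k\<in>deviations n S. y k * incentive_sum n S U k (\<lambda>s. \<Prod>i\<in>{1..n}. p i (s i))) = 0"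
proof -
  let ?x = "\<lambda>s. \<Prod>i\<in>{1..n}. p i (s i)"
  have zero: "(\<Sum>a\<in>S i. \<Sum>b\<in>S i. y (i, a, b) * incentive_sum n S U (i, a, b) ?x) = 0"
    if i: "i \<in> {1..n}" for i
  proof -
    \<comment> \<open>The opponents' factor, which is independent of the strategy of player
      \<open>i\<close>.\<close>
    define q where "q r = (\<Prod>j\<in>{1..n} - {i}. p j (r j))" for r :: "nat \<Rightarrow> 's"
    have x: "?x (r(i := a)) = p i a * q r" for r a
      using i by (subst prod.remove [of _ i]) (auto simp: q_def intro!: prod.cong)
    have "(\<Sum>a\<in>S i. \<Sum>b\<in>S i. y (i, a, b) * incentive_sum n S U (i, a, b) ?x) =
        (\<Sum>a\<in>S i. \<Sum>b\<in>S i. \<Sum>r\<in>opponent_profiles n S i.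
          y (i, a, b) * (p i a * q r * (U i (r(i := a)) - U i (r(i := b)))))"
      by (intro sum.cong refl) (simp only: incentive_sum_opponents [OF fin i] x sum_distrib_left)
    also have "\<dots> = (\<Sum>r\<in>opponent_profiles n S i. \<Sum>a\<in>S i. \<Sum>b\<in>S i.
          y (i, a, b) * (p i a * q r * (U i (r(i := a)) - U i (r(i := b)))))"
    proof -
      have swap: "(\<Sum>a\<in>S i. \<Sum>b\<in>S i. \<Sum>r\<in>R. f a b r) = (\<Sum>r\<in>R. \<Sum>a\<in>S i. \<Sum>b\<in>S i. f a b r)"
        for f :: "'s \<Rightarrow> 's \<Rightarrow> (nat \<Rightarrow> 's) \<Rightarrow> real" and R
        by (subst sum.swap [symmetric]) (intro sum.cong refl sum.swap)
      show ?thesis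
        by (rule swap)
    qed
    also have "\<dots> = (\<Sum>r\<in>opponent_profiles n S i. q r *
        ((\<Sum>a\<in>S i. U i (r(i := a)) * (p i a * (\<Sum>b\<in>S i. y (i, a, b)))) -
         (\<Sum>a\<in>S i. \<Sum>b\<in>S i. U i (r(i := b)) * (p i a * y (i, a, b)))))"
      by (intro sum.cong refl) (simp add: algebra_simps sum_subtractf sum_distrib_left)
    also have "\<dots> = 0"
    proof -
      have "(\<Sum>a\<in>S i. \<Sum>b\<in>S i. U i (r(i := b)) * (p i a * y (i, a, b))) =
          (\<Sum>b\<in>S i. U i (r(i := b)) * (\<Sum>a\<in>S i. p i a * y (i, a, b)))" for r
        unfolding sum_distrib_left by (rule sum.swap)
      then show ?thesis
        using st [OF i] by simp
    qed
    finally show ?thesis .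
  qed
  have "(\<Sum>k\<in>deviations n S. y k * incentive_sum n S U k ?x) =
      (\<Sum>i\<in>{1..n}. \<Sum>a\<in>S i. \<Sum>b\<in>S i. y (i, a, b) * incentive_sum n S U (i, a, b) ?x)"
    unfolding deviations_def sum.cartesian_product
    using fin by (subst sum.Sigma) (auto simp: split_def)
  also have "\<dots> = 0"
    by (intro sum.neutral ballI zero)
  finally show ?thesis .
qed

lemma sum_product_profiles:
  fixes p :: "nat \<Rightarrow> 's \<Rightarrow> real"
  assumes "\<forall>i\<in>{1..n}. finite (S i)" "\<And>i. i \<in> {1..n} \<Longrightarrow> (\<Sum>a\<in>S i. p i a) = 1"
  shows "(\<Sum>s\<in>profiles n S. \<Prod>i\<in>{1..n}. p i (s i)) = 1"
proof -
  have "(\<Sum>s\<in>profiles n S. \<Prod>i\<in>{1..n}. p i (s i)) = (\<Prod>i\<in>{1..n}. \<Sum>a\<in>S i. p i a)"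
    unfolding profiles_def using assms by (intro prod_sum_PiE [symmetric]) auto
  then show ?thesis
    using assms by simp
qed

text \<open>Stationary distributions are taken on the sets \<open>R i\<close> and extended by zero.
  They stay stationary on \<open>S i\<close> because no transition of positive rate leaves
  \<open>R i\<close>. Their supports are closed under transitions, since positive inflow into a
  strategy forces positive mass there.\<close>

lemma balanced_product:
  fixes y :: "nat \<times> 's \<times> 's \<Rightarrow> real"
  assumes fin: "\<forall>i\<in>{1..n}. finite (S i)"
    and R: "\<And>i. i \<in> {1..n} \<Longrightarrow> R i \<subseteq> S i" "\<And>i. i \<in> {1..n} \<Longrightarrow> R i \<noteq> {}"
    and y: "\<And>k. k \<in> deviations n S \<Longrightarrow> 0 \<le> y k"
    and closed: "\<And>i a b. \<lbrakk>i \<in> {1..n}; a \<in> R i; b \<in> S i - R i\<rbrakk> \<Longrightarrow> y (i, a, b) = 0"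
  obtains p where "\<And>i a. i \<in> {1..n} \<Longrightarrow> 0 \<le> p i a"
    "\<And>i a. \<lbrakk>i \<in> {1..n}; a \<notin> R i\<rbrakk> \<Longrightarrow> p i a = 0"
    "\<And>i. i \<in> {1..n} \<Longrightarrow> (\<Sum>a\<in>S i. p i a) = 1"
    "\<And>i a b. \<lbrakk>i \<in> {1..n}; a \<in> S i; b \<in> S i; p i a \<noteq> 0; y (i, a, b) \<noteq> 0\<rbrakk> \<Longrightarrow> p i b \<noteq> 0"
    "\<And>U. (\<Sum>k\<in>deviations n S. y k * incentive_sum n S U k (\<lambda>s. \<Prod>i\<in>{1..n}. p i (s i))) = 0"
proof -
  define P where "P i p \<longleftrightarrow> (\<forall>a. 0 \<le> p a) \<and> (\<forall>a. a \<notin> R i \<longrightarrow> p a = 0) \<and> (\<Sum>a\<in>S i. p a) = 1 \<and>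
    (\<forall>b\<in>S i. (\<Sum>a\<in>S i. p a * y (i, a, b)) = p b * (\<Sum>a\<in>S i. y (i, b, a)))"
    for i and p :: "'s \<Rightarrow> real"
  have "\<exists>p. P i p" if i: "i \<in> {1..n}" for i
  proof -
    have finS: "finite (S i)" and RS: "R i \<subseteq> S i"
      using fin R(1) i by auto
    obtain q where q: "\<And>a. a \<in> R i \<Longrightarrow> 0 \<le> q a" "(\<Sum>a\<in>R i. q a) = 1"
      "\<And>b. b \<in> R i \<Longrightarrow> (\<Sum>a\<in>R i. q a * y (i, a, b)) = q b * (\<Sum>a\<in>R i. y (i, b, a))"
    proof (rule stationary_exists [of "R i" "\<lambda>a b. y (i, a, b)"])
      show "0 \<le> y (i, a, b)" if "a \<in> R i" "b \<in> R i" for a b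
        using y [of "(i, a, b)"] that RS i by (auto simp: deviations_def)
    qed (use R(2) i finite_subset [OF RS finS] in auto)
    define p where "p a = (if a \<in> R i then q a else 0)" for a
    have sum_R: "(\<Sum>a\<in>S i. p a * f a) = (\<Sum>a\<in>R i. q a * f a)" for f
      using RS finS by (intro sum.mono_neutral_cong_right) (auto simp: p_def)
    have "P i p"
      unfolding P_def
    proof (intro conjI ballI)
      show "(\<Sum>a\<in>S i. p a) = 1"
        using sum_R [of "\<lambda>_. 1"] q(2) by simp
      show "(\<Sum>a\<in>S i. p a * y (i, a, b)) = p b * (\<Sum>a\<in>S i. y (i, b, a))" if b: "b \<in> S i" for b
      proof (cases "b \<in> R i")
        case True
        then have "(\<Sum>a\<in>S i. y (i, b, a)) = (\<Sum>a\<in>R i. y (i, b, a))"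
          using RS finS closed i by (intro sum.mono_neutral_right) auto
        then show ?thesis
          unfolding sum_R using q(3) [OF True] True by (simp add: p_def)
      next
        case False
        \<comment> \<open>Outside \<open>R i\<close> there is no mass to flow out, and nothing flows
          in from \<open>R i\<close>.\<close>
        then show ?thesis
          unfolding sum_R using closed i b by (simp add: p_def)
      qed
    qed (auto simp: p_def q)
    then show ?thesis by blast
  qed
  then have "\<exists>p. \<forall>i\<in>{1..n}. P i (p i)"
    by (intro bchoice ballI)
  then obtain p where p: "\<And>i. i \<in> {1..n} \<Longrightarrow> P i (p i)"
    by blast
  show ?thesis
  proof (rule that [of p])
    fix i a b
    assume i: "i \<in> {1..n}" and ab: "a \<in> S i" "b \<in> S i" and nz: "p i a \<noteq> 0" "y (i, a, b) \<noteq> 0"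
    have nonneg: "0 \<le> p i c * y (i, c, b)" if "c \<in> S i" for c
      using p [OF i] y i that ab by (auto simp: P_def deviations_def)
    then have "p i a * y (i, a, b) \<le> (\<Sum>c\<in>S i. p i c * y (i, c, b))"
      using fin i ab by (intro member_le_sum) auto
    moreover have "0 < p i a * y (i, a, b)"
      using nonneg [of a] nz ab by (simp add: less_le)
    ultimately show "p i b \<noteq> 0"
      using p [OF i] ab by (auto simp: P_def)
  next
    show "(\<Sum>k\<in>deviations n S. y k * incentive_sum n S U k (\<lambda>s. \<Prod>i\<in>{1..n}. p i (s i))) = 0" for U
      using p by (intro stationary_product fin) (auto simp: P_def)
  qed (use p in \<open>auto simp: P_def\<close>)
qed

text \<open>If no nonzero nonnegative vector met all constraints, Farkas' lemma would give weights
  whose combination is at most \<open>-1\<close> at every profile. Its expectation under the product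
  of stationary distributions is \<open>0\<close>, a contradiction.\<close>

lemma correlated_equilibrium_exists:
  assumes fin: "\<forall>i\<in>{1..n}. finite (S i)" and ne: "\<forall>i\<in>{1..n}. S i \<noteq> {}"
  obtains \<mu> where "correlated_equilibrium n S U \<mu>"
proof -
  let ?A = "profiles n S"
  have "\<exists>x. (\<forall>k\<in>deviations n S. 0 \<le> incentive_sum n S U k x) \<and> (\<forall>s\<in>?A. 0 \<le> x s) \<and>
      0 < (\<Sum>s\<in>?A. x s)"
  proof (rule ccontr)
    assume neg: "\<nexists>x. (\<forall>k\<in>deviations n S. 0 \<le> incentive_sum n S U k x) \<and> (\<forall>s\<in>?A. 0 \<le> x s) \<and>
      0 < (\<Sum>s\<in>?A. x s)"
    obtain y where y: "\<And>k. k \<in> deviations n S \<Longrightarrow> 0 \<le> y k"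
      "\<And>s. s \<in> ?A \<Longrightarrow> (\<Sum>k\<in>deviations n S. y k * incentive U k s) \<le> - 1"
    proof (rule farkas_signed [of "deviations n S" ?A ?A "incentive U" "\<lambda>_. -1"])
      fix x assume "\<And>k. k \<in> deviations n S \<Longrightarrow> 0 \<le> (\<Sum>s\<in>?A. incentive U k s * x s)"
        "\<And>s. s \<in> ?A \<Longrightarrow> 0 \<le> x s"
      then have "\<not> 0 < (\<Sum>s\<in>?A. x s)"
        using neg unfolding incentive_sum_def by blast
      then show "0 \<le> (\<Sum>s\<in>?A. - 1 * x s)"
        by (simp add: sum_negf)
    qed (use fin finite_profiles finite_deviations in auto)
    obtain p where p: "\<And>i a. i \<in> {1..n} \<Longrightarrow> 0 \<le> p i a"
      "\<And>i. i \<in> {1..n} \<Longrightarrow> (\<Sum>a\<in>S i. p i a) = 1"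
      "\<And>U. (\<Sum>k\<in>deviations n S. y k * incentive_sum n S U k (\<lambda>s. \<Prod>i\<in>{1..n}. p i (s i))) = 0"
      by (rule balanced_product [of n S S y]) (use fin ne y(1) in auto)
    define x where "x s = (\<Prod>i\<in>{1..n}. p i (s i))" for s
    have x0: "0 \<le> x s" if "s \<in> ?A" for s
      using p by (auto simp: x_def intro!: prod_nonneg)
    have x1: "(\<Sum>s\<in>?A. x s) = 1"
      unfolding x_def using p fin by (intro sum_product_profiles) auto
    have "0 = (\<Sum>k\<in>deviations n S. y k * incentive_sum n S U k x)"
      unfolding x_def by (simp only: p)
    also have "\<dots> = (\<Sum>s\<in>?A. (\<Sum>k\<in>deviations n S. y k * incentive U k s) * x s)"
      by (rule weighted_incentive_sum)
    also have "\<dots> \<le> (\<Sum>s\<in>?A. - 1 * x s)"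
      using x0 y(2) by (intro sum_mono mult_right_mono) auto
    also have "\<dots> = - 1"
      using x1 by (simp add: sum_negf)
    finally show False
      by simp
  qed
  then obtain x where x: "\<And>k. k \<in> deviations n S \<Longrightarrow> 0 \<le> incentive_sum n S U k x"
    "\<And>s. s \<in> ?A \<Longrightarrow> 0 \<le> x s" "0 < (\<Sum>s\<in>?A. x s)"
    by blast
  define t where "t = (\<Sum>s\<in>?A. x s)"
  have "incentive_sum n S U k (\<lambda>s. x s / t) = incentive_sum n S U k x / t" for k
    by (simp add: incentive_sum_def sum_divide_distrib)
  then have "0 \<le> incentive_sum n S U k (\<lambda>s. x s / t)" if "k \<in> deviations n S" for k
    using x that by (simp add: t_def)
  moreover have "(\<Sum>s\<in>?A. x s / t) = 1"
    using x by (simp add: t_def flip: sum_divide_distrib)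
  moreover have "0 \<le> x s / t" if "s \<in> ?A" for s
    using x that by (simp add: t_def)
  ultimately obtain \<mu> where "correlated_equilibrium n S U \<mu>"
    using correlated_equilibrium_of_vector [OF fin, of "\<lambda>s. x s / t" U] by metis
  then show ?thesis
    by (rule that)
qed

section \<open>Duality: weights obtained from uniqueness\<close>

text \<open>
  Applying Farkas' lemma to the negated sum of all constraints makes every weight at least \<open>1\<close>.
\<close>

lemma balance_certificate:
  fixes S :: "nat \<Rightarrow> 's set"
  assumes fin: "\<forall>i\<in>{1..n}. finite (S i)" and K: "K \<subseteq> deviations n S" and Z: "Z \<subseteq> profiles n S"
    and only_zero: "\<And>x s. \<lbrakk>\<forall>k\<in>K. 0 \<le> incentive_sum n S U k x; \<forall>s\<in>Z. 0 \<le> x s;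
      (\<Sum>s\<in>profiles n S. x s) = 0; s \<in> profiles n S\<rbrakk> \<Longrightarrow> x s = 0"
  obtains y c where "\<And>k. 0 \<le> y k" "\<And>k. y k \<noteq> 0 \<longleftrightarrow> k \<in> K"
    "\<And>s. s \<in> Z \<Longrightarrow> (\<Sum>k\<in>deviations n S. y k * incentive U k s) < c"
    "\<And>s. s \<in> profiles n S - Z \<Longrightarrow> (\<Sum>k\<in>deviations n S. y k * incentive U k s) = c"
proof -
  let ?A = "profiles n S"
  \<comment> \<open>The two Boolean indices carry the total mass and its negative, encoding the
    equation that the entries sum to \<open>0\<close>. The difference of their multipliers becomes
    \<open>c\<close>.\<close>
  define f where "f q s = (case q of Inl k \<Rightarrow> incentive U k s | Inr b \<Rightarrow> if b then 1 else - 1)"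
    for q :: "(nat \<times> 's \<times> 's) + bool" and s
  \<comment> \<open>Subtracting \<open>1\<close> on \<open>Z\<close> produces the strict inequality
    there.\<close>
  define g where "g s = - (\<Sum>k\<in>K. incentive U k s) - of_bool (s \<in> Z)" for s
  have finK: "finite K"
    using K finite_deviations [OF fin] finite_subset by blast
  obtain l where l: "\<And>q. q \<in> K <+> UNIV \<Longrightarrow> 0 \<le> l q"
    "\<And>s. s \<in> Z \<Longrightarrow> (\<Sum>q\<in>K <+> UNIV. l q * f q s) \<le> g s"
    "\<And>s. s \<in> ?A - Z \<Longrightarrow> (\<Sum>q\<in>K <+> UNIV. l q * f q s) = g s"
  proof (rule farkas_signed [of "K <+> UNIV" ?A Z f g])
    fix x assume x: "\<And>q. q \<in> K <+> UNIV \<Longrightarrow> 0 \<le> (\<Sum>s\<in>?A. f q s * x s)" "\<And>s. s \<in> Z \<Longrightarrow> 0 \<le> x s"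
    have "0 \<le> incentive_sum n S U k x" if "k \<in> K" for k
      using x(1) [OF InlI [OF that]] by (simp add: f_def incentive_sum_def)
    moreover have "(\<Sum>s\<in>?A. x s) = 0"
      using x(1) [OF InrI [of True]] x(1) [OF InrI [of False]] by (simp add: f_def sum_negf)
    ultimately have "x s = 0" if "s \<in> ?A" for s
      using only_zero x(2) that by blast
    then show "0 \<le> (\<Sum>s\<in>?A. g s * x s)"
      by simp
  qed (use finK finite_profiles [OF fin] Z in auto)
  define y where "y k = (if k \<in> K then 1 + l (Inl k) else 0)" for k
  define c where "c = l (Inr False) - l (Inr True)"
  have "(\<Sum>q\<in>K <+> UNIV. l q * f q s) = (\<Sum>k\<in>K. l (Inl k) * incentive U k s) - c" for s
    using finK by (simp add: sum.Plus f_def c_def UNIV_bool)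
  moreover have "(\<Sum>k\<in>deviations n S. y k * incentive U k s) =
      (\<Sum>k\<in>K. incentive U k s) + (\<Sum>k\<in>K. l (Inl k) * incentive U k s)" for s
  proof -
    have "(\<Sum>k\<in>deviations n S. y k * incentive U k s) = (\<Sum>k\<in>K. (1 + l (Inl k)) * incentive U k s)"
      using K finite_deviations [OF fin] by (intro sum.mono_neutral_cong_right) (auto simp: y_def)
    then show ?thesis
      by (simp add: algebra_simps sum.distrib)
  qed
  ultimately have eq: "(\<Sum>k\<in>deviations n S. y k * incentive U k s) =
      c - g s - of_bool (s \<in> Z) + (\<Sum>q\<in>K <+> UNIV. l q * f q s)" for s
    by (simp add: g_def)
  show ?thesis
  proof (rule that [of y c])
    show "0 \<le> y k" and "y k \<noteq> 0 \<longleftrightarrow> k \<in> K" for k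
      using l(1) [OF InlI, of k] by (auto simp: y_def)
    show "(\<Sum>k\<in>deviations n S. y k * incentive U k s) < c" if "s \<in> Z" for s
      using l(2) [OF that] that unfolding eq by simp
    show "(\<Sum>k\<in>deviations n S. y k * incentive U k s) = c" if "s \<in> ?A - Z" for s
      using l(3) [OF that] that unfolding eq by simp
  qed
qed

text \<open>A slack constraint survives a small step by continuity, a binding one by the sign of its
  slope.\<close>

lemma eventually_nonneg_ray:
  fixes a b :: real
  assumes "0 < a \<or> a = 0 \<and> 0 \<le> b"
  shows "eventually (\<lambda>e. 0 \<le> a + e * b) (at_right 0)"
proof (cases "0 < a")
  case True
  have "((\<lambda>e. a + e * b) \<longlongrightarrow> a + 0 * b) (at_right 0)"
    by (intro tendsto_intros)
  then have "eventually (\<lambda>e. 0 < a + e * b) (at_right 0)"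
    using True by (intro order_tendstoD(1)) auto
  then show ?thesis
    by (rule eventually_mono) simp
next
  case False
  then show ?thesis
    using assms eventually_at_right_less [of "0 :: real"] by (auto elim!: eventually_mono)
qed

text \<open>Such an \<open>x\<close> is a feasible direction at \<open>\<sigma>\<close>: for small
  \<open>e > 0\<close> the vector \<open>pmf \<sigma> + e * x\<close> is again an equilibrium, hence
  equals \<open>\<sigma>\<close>.\<close>

lemma unique_equilibrium_only_zero_direction:
  assumes fin: "\<forall>i\<in>{1..n}. finite (S i)" and uniq: "unique_correlated_equilibrium n S G \<sigma>"
    and inc: "\<And>k. \<lbrakk>k \<in> deviations n S; incentive_sum n S G k (pmf \<sigma>) = 0\<rbrakk> \<Longrightarrow> 0 \<le> incentive_sum n S G k x"
    and nonneg: "\<And>s. s \<in> profiles n S - set_pmf \<sigma> \<Longrightarrow> 0 \<le> x s"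
    and sum0: "(\<Sum>s\<in>profiles n S. x s) = 0" and "s \<in> profiles n S"
  shows "x s = 0"
proof -
  have ce: "correlated_equilibrium n S G \<sigma>"
    using uniq by (simp add: unique_correlated_equilibrium_def)
  \<comment> \<open>There are finitely many constraints, so one step size serves them all.\<close>
  have "eventually (\<lambda>e. (\<forall>k\<in>deviations n S. 0 \<le> incentive_sum n S G k (pmf \<sigma>) + e * incentive_sum n S G k x) \<and>
      (\<forall>s\<in>profiles n S. 0 \<le> pmf \<sigma> s + e * x s) \<and> 0 < e) (at_right 0)"
    using ce inc nonneg fin
    by (intro eventually_conj eventually_ball_finite ballI eventually_nonneg_ray eventually_at_right_less
        finite_deviations finite_profiles)
      (auto simp: correlated_equilibrium_iff [OF fin] order_less_le set_pmf_iff)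
  then obtain e where e: "0 < e" "\<And>s. s \<in> profiles n S \<Longrightarrow> 0 \<le> pmf \<sigma> s + e * x s"
    "\<And>k. k \<in> deviations n S \<Longrightarrow> 0 \<le> incentive_sum n S G k (pmf \<sigma>) + e * incentive_sum n S G k x"
    by (auto dest!: eventually_happens)
  have "(\<Sum>s\<in>profiles n S. pmf \<sigma> s + e * x s) = 1"
    using ce fin sum0
    by (simp add: sum.distrib sum_pmf_profiles correlated_equilibrium_def flip: sum_distrib_left)
  then obtain \<mu> where \<mu>: "correlated_equilibrium n S G \<mu>"
    "\<And>s. s \<in> profiles n S \<Longrightarrow> pmf \<mu> s = pmf \<sigma> s + e * x s"
    using correlated_equilibrium_of_vector [OF fin, of "\<lambda>s. pmf \<sigma> s + e * x s" G] e
    by (auto simp: incentive_sum_add_scaled)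
  have "\<mu> = \<sigma>"
    using \<mu>(1) uniq by (simp add: unique_correlated_equilibrium_def)
  then show ?thesis
    using \<mu>(2) [OF \<open>s \<in> profiles n S\<close>] e(1) by simp
qed

section \<open>Compactness: open conditions on games\<close>

text \<open>The set is the projection of a closed set along a compact factor, and such projections
  are closed maps.\<close>

lemma closedin_exists_nonneg:
  assumes "compact_space X"
    and cont: "\<And>f. f \<in> F \<Longrightarrow> continuous_map (prod_topology X Y) euclideanreal f"
  shows "closedin Y {u \<in> topspace Y. \<exists>x\<in>topspace X. \<forall>f\<in>F. 0 \<le> f (x, u)}"
proof -
  let ?C = "\<lambda>f. {z \<in> topspace (prod_topology X Y). f z \<in> {0::real..}}"
  \<comment> \<open>Inserting the zero function keeps the intersection nonempty-indexed, and so
    within the product space, even for empty \<open>F\<close>.\<close>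
  have "closedin (prod_topology X Y) (\<Inter>f\<in>insert (\<lambda>_. 0) F. ?C f)"
  proof (rule closedin_INT)
    fix f assume "f \<in> insert (\<lambda>_. 0) F"
    then have "continuous_map (prod_topology X Y) euclideanreal f"
      using cont by auto
    then show "closedin (prod_topology X Y) (?C f)"
      by (rule closedin_continuous_map_preimage) auto
  qed auto
  then have "closedin Y (snd ` (\<Inter>f\<in>insert (\<lambda>_. 0) F. ?C f))"
    using Abstract_Topological_Spaces.closed_map_snd [OF \<open>compact_space X\<close>, of Y]
    unfolding closed_map_def by blast
  also have "snd ` (\<Inter>f\<in>insert (\<lambda>_. 0) F. ?C f) =
      {u \<in> topspace Y. \<exists>x\<in>topspace X. \<forall>f\<in>F. 0 \<le> f (x, u)}"
    unfolding snd_eq_Range set_eq_iff Range_iff by auto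
  finally show ?thesis .
qed

text \<open>A compact box containing all probability vectors and all directions of l1-norm
  \<open>1\<close>, as extensional functions.\<close>

definition cube_topology :: "'a set \<Rightarrow> ('a \<Rightarrow> real) topology"
  where "cube_topology A = product_topology (\<lambda>_. top_of_set {-1..1}) A"

lemma topspace_cube_topology: "topspace (cube_topology A) = (\<Pi>\<^sub>E s\<in>A. {-1..1})"
  by (simp add: cube_topology_def)

lemma compact_space_cube_topology: "compact_space (cube_topology A)"
  by (simp add: cube_topology_def compact_space_product_topology compact_space_subtopology)

lemma continuous_map_cube_component:
  "s \<in> A \<Longrightarrow> continuous_map (cube_topology A) euclideanreal (\<lambda>x. x s)"
  unfolding cube_topology_def
  by (rule continuous_map_into_fulltopology, rule continuous_map_product_projection)

lemma continuous_map_payoff: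
  assumes "i \<in> {1..n}" "s \<in> profiles n S"
  shows "continuous_map (game_topology n S) euclideanreal (\<lambda>U. U i s)"
proof -
  have "continuous_map (game_topology n S) (product_topology (\<lambda>s. euclideanreal) (profiles n S)) (\<lambda>U. U i)"
    unfolding game_topology_def using assms(1) by (rule continuous_map_product_projection)
  from continuous_map_compose [OF this continuous_map_product_projection [OF assms(2)]]
  show ?thesis
    by (simp add: o_def)
qed

lemma continuous_map_incentive_sum:
  assumes fin: "\<forall>i\<in>{1..n}. finite (S i)" and k: "k \<in> deviations n S"
  shows "continuous_map (prod_topology (cube_topology (profiles n S)) (game_topology n S))
    euclideanreal (\<lambda>z. incentive_sum n S (snd z) k (fst z))"
proof -
  let ?P = "prod_topology (cube_topology (profiles n S)) (game_topology n S)"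
  obtain i a b where k_eq: "k = (i, a, b)" and i: "i \<in> {1..n}" and b: "b \<in> S i"
    using k by (auto simp: deviations_def)
  have x: "continuous_map ?P euclideanreal (\<lambda>z. fst z s)" if "s \<in> profiles n S" for s
    using continuous_map_compose [OF continuous_map_fst continuous_map_cube_component [OF that]]
    by (simp add: o_def)
  have U: "continuous_map ?P euclideanreal (\<lambda>z. snd z i s)" if "s \<in> profiles n S" for s
    using continuous_map_compose [OF continuous_map_snd continuous_map_payoff [OF i that]]
    by (simp add: o_def)
  have upd: "s(i := b) \<in> profiles n S" if "s \<in> profiles n S" for s
    using that i b by (auto simp: profiles_def PiE_iff extensional_def)
  have "continuous_map ?P euclideanreal (\<lambda>z. incentive (snd z) k s)" if "s \<in> profiles n S" for s
    using U that upd by (cases "s i = a") (auto simp: incentive_def k_eq intro!: continuous_map_diff)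
  then show ?thesis
    unfolding incentive_sum_def using x finite_profiles [OF fin]
    by (intro continuous_map_sum continuous_map_real_mult)
qed

lemma closedin_solvable:
  assumes fin: "\<forall>i\<in>{1..n}. finite (S i)" and K: "K \<subseteq> deviations n S"
    and F: "\<And>f. f \<in> F \<Longrightarrow> continuous_map (cube_topology (profiles n S)) euclideanreal f"
  shows "closedin (game_topology n S) {U \<in> games n S. \<exists>x\<in>(\<Pi>\<^sub>E s\<in>profiles n S. {-1..1}).
    (\<forall>k\<in>K. 0 \<le> incentive_sum n S U k x) \<and> (\<forall>f\<in>F. 0 \<le> f x)}"
proof -
  have "closedin (game_topology n S) {U \<in> topspace (game_topology n S).
      \<exists>x\<in>topspace (cube_topology (profiles n S)).
      \<forall>f\<in>(\<lambda>k z. incentive_sum n S (snd z) k (fst z)) ` K \<union> (\<lambda>f z. f (fst z)) ` F. 0 \<le> f (x, U)}"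
  proof (rule closedin_exists_nonneg [OF compact_space_cube_topology])
    fix h assume "h \<in> (\<lambda>k z. incentive_sum n S (snd z) k (fst z)) ` K \<union> (\<lambda>f z. f (fst z)) ` F"
    then show "continuous_map (prod_topology (cube_topology (profiles n S)) (game_topology n S))
        euclideanreal h"
      using continuous_map_incentive_sum [OF fin] K
        continuous_map_compose [OF continuous_map_fst F, of _ "game_topology n S"]
      by (auto simp: o_def)
  qed
  then show ?thesis
    by (simp add: topspace_game_topology topspace_cube_topology ball_Un)
qed

text \<open>In the complement some nonzero direction exists. Rescaled to l1-norm \<open>1\<close> it
  lies in the compact cube, so the complement is closed.\<close>

lemma openin_only_zero_direction:
  assumes fin: "\<forall>i\<in>{1..n}. finite (S i)" and K: "K \<subseteq> deviations n S" and Z: "Z \<subseteq> profiles n S"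
  shows "openin (game_topology n S) {U \<in> games n S. \<forall>x. (\<forall>k\<in>K. 0 \<le> incentive_sum n S U k x) \<longrightarrow>
    (\<forall>s\<in>Z. 0 \<le> x s) \<longrightarrow> (\<Sum>s\<in>profiles n S. x s) = 0 \<longrightarrow> (\<forall>s\<in>profiles n S. x s = 0)}"
    (is "openin _ ?N")
proof -
  let ?A = "profiles n S"
  \<comment> \<open>Two opposite functionals force the sum to be \<open>0\<close>; the last one asks
    for l1-norm at least \<open>1\<close>, which excludes the zero vector.\<close>
  define F :: "(((nat \<Rightarrow> 'a) \<Rightarrow> real) \<Rightarrow> real) set"
    where "F = (\<lambda>s x. x s) ` Z \<union>
      {\<lambda>x. \<Sum>s\<in>?A. x s, \<lambda>x. - (\<Sum>s\<in>?A. x s), \<lambda>x. (\<Sum>s\<in>?A. \<bar>x s\<bar>) - 1}"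
  have finA: "finite ?A"
    using fin by (rule finite_profiles)
  let ?bad = "{U \<in> games n S. \<exists>x\<in>(\<Pi>\<^sub>E s\<in>?A. {-1..1}).
    (\<forall>k\<in>K. 0 \<le> incentive_sum n S U k x) \<and> (\<forall>f\<in>F. 0 \<le> f x)}"
  have bad: "closedin (game_topology n S) ?bad"
  proof (rule closedin_solvable [OF fin K])
    fix f assume "f \<in> F"
    then show "continuous_map (cube_topology ?A) euclideanreal f"
      using Z finA by (auto simp: F_def intro!: continuous_intros continuous_map_cube_component)
  qed
  have "?N = topspace (game_topology n S) - ?bad"
  proof (intro subset_antisym subsetI)
    fix U assume U: "U \<in> ?N"
    have False if "\<forall>k\<in>K. 0 \<le> incentive_sum n S U k x" "\<forall>f\<in>F. 0 \<le> f x" for x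
    proof -
      have "\<forall>s\<in>Z. 0 \<le> x s" "(\<Sum>s\<in>?A. x s) = 0" "(\<Sum>s\<in>?A. \<bar>x s\<bar>) \<ge> 1"
        using that(2) by (auto simp: F_def ball_Un)
      moreover from this have "\<forall>s\<in>?A. x s = 0"
        using U that(1) by blast
      ultimately show False
        by simp
    qed
    then have "U \<notin> ?bad"
      by blast
    then show "U \<in> topspace (game_topology n S) - ?bad"
      using U by (simp add: topspace_game_topology)
  next
    fix U assume U: "U \<in> topspace (game_topology n S) - ?bad"
    have "x s = 0" if x: "\<forall>k\<in>K. 0 \<le> incentive_sum n S U k x" "\<forall>s\<in>Z. 0 \<le> x s"
      "(\<Sum>s\<in>?A. x s) = 0" and s: "s \<in> ?A" for x s
    proof (rule ccontr)
      assume nz: "x s \<noteq> 0"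
      define t where "t = (\<Sum>s\<in>?A. \<bar>x s\<bar>)"
      have le_t: "\<bar>x r\<bar> \<le> t" if "r \<in> ?A" for r
        unfolding t_def using that finA by (intro member_le_sum) auto
      then have t: "t > 0"
        using nz s by force
      define z where "z = (\<lambda>r\<in>?A. x r / t)"
      have "z \<in> (\<Pi>\<^sub>E s\<in>?A. {-1..1})"
      proof -
        have "- 1 \<le> x r / t \<and> x r / t \<le> 1" if "r \<in> ?A" for r
          using le_t [OF that] t by (simp add: field_simps abs_le_iff)
        then show ?thesis
          by (auto simp: z_def)
      qed
      moreover have "incentive_sum n S U k z = incentive_sum n S U k x / t" for k
        by (simp add: z_def incentive_sum_def sum_divide_distrib)
      moreover have "(\<Sum>s\<in>?A. z s) = 0"
        using x(3) by (simp add: z_def flip: sum_divide_distrib)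
      moreover have "(\<Sum>s\<in>?A. \<bar>z s\<bar>) = 1"
        using t by (simp add: z_def t_def flip: sum_divide_distrib)
      moreover have "\<forall>s\<in>Z. 0 \<le> z s"
        using x(2) t Z by (auto simp: z_def)
      ultimately have "U \<in> ?bad"
        using U t x(1) by (auto simp: F_def topspace_game_topology intro!: bexI [of _ z])
      then show False
        using U by blast
    qed
    then show "U \<in> ?N"
      using U by (simp add: topspace_game_topology)
  qed
  then show ?thesis
    using bad by (simp add: openin_diff)
qed

text \<open>The complement consists of the games having an equilibrium with probability
  \<open>0\<close> at \<open>t\<close>; it is closed because probability vectors form a compact
  set.\<close>

lemma openin_positive_probability:
  assumes fin: "\<forall>i\<in>{1..n}. finite (S i)" and t: "t \<in> profiles n S"
  shows "openin (game_topology n S)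
    {U \<in> games n S. \<forall>\<mu>. correlated_equilibrium n S U \<mu> \<longrightarrow> t \<in> set_pmf \<mu>}" (is "openin _ ?N")
proof -
  let ?A = "profiles n S"
  \<comment> \<open>Together these functionals describe the probability vectors vanishing at
    \<open>t\<close>.\<close>
  define F :: "(((nat \<Rightarrow> 'a) \<Rightarrow> real) \<Rightarrow> real) set"
    where "F = (\<lambda>s x. x s) ` ?A \<union>
      {\<lambda>x. (\<Sum>s\<in>?A. x s) - 1, \<lambda>x. 1 - (\<Sum>s\<in>?A. x s), \<lambda>x. - x t}"
  have finA: "finite ?A"
    using fin by (rule finite_profiles)
  let ?bad = "{U \<in> games n S. \<exists>x\<in>(\<Pi>\<^sub>E s\<in>?A. {-1..1}).
    (\<forall>k\<in>deviations n S. 0 \<le> incentive_sum n S U k x) \<and> (\<forall>f\<in>F. 0 \<le> f x)}"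
  have bad: "closedin (game_topology n S) ?bad"
  proof (rule closedin_solvable [OF fin order_refl])
    fix f assume "f \<in> F"
    then show "continuous_map (cube_topology ?A) euclideanreal f"
      using t finA by (auto simp: F_def intro!: continuous_intros continuous_map_cube_component)
  qed
  have "?N = topspace (game_topology n S) - ?bad"
  proof (intro subset_antisym subsetI)
    fix U assume U: "U \<in> ?N"
    have False if x: "\<forall>k\<in>deviations n S. 0 \<le> incentive_sum n S U k x" "\<forall>f\<in>F. 0 \<le> f x" for x
    proof -
      have F: "\<forall>s\<in>?A. 0 \<le> x s" "(\<Sum>s\<in>?A. x s) = 1" "x t \<le> 0"
        using x(2) by (auto simp: F_def ball_Un)
      obtain \<mu> where "correlated_equilibrium n S U \<mu>" "pmf \<mu> t = x t"
        using correlated_equilibrium_of_vector [OF fin, of x U] F x(1) t by metis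
      then show False
        using U F(1,3) t by (force simp: set_pmf_iff)
    qed
    then have "U \<notin> ?bad"
      by blast
    then show "U \<in> topspace (game_topology n S) - ?bad"
      using U by (simp add: topspace_game_topology)
  next
    fix U assume U: "U \<in> topspace (game_topology n S) - ?bad"
    have "t \<in> set_pmf \<mu>" if \<mu>: "correlated_equilibrium n S U \<mu>" for \<mu>
    proof (rule ccontr)
      assume t0: "t \<notin> set_pmf \<mu>"
      define z where "z = restrict (pmf \<mu>) ?A"
      have "z \<in> (\<Pi>\<^sub>E s\<in>?A. {-1..1})"
      proof -
        have "- 1 \<le> pmf \<mu> s" for s
          using pmf_nonneg [of \<mu> s] by linarith
        then show ?thesis
          by (auto simp: z_def pmf_le_1)
      qed
      moreover have "incentive_sum n S U k z = incentive_sum n S U k (pmf \<mu>)" for k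
        by (rule incentive_sum_cong) (simp add: z_def)
      moreover have "(\<Sum>s\<in>?A. z s) = 1"
        using \<mu> sum_pmf_profiles [OF fin] by (simp add: z_def correlated_equilibrium_def)
      moreover have "\<forall>s\<in>?A. 0 \<le> z s" "z t = 0"
        using t0 t by (auto simp: z_def set_pmf_iff)
      ultimately have "U \<in> ?bad"
        using U \<mu> by (auto simp: F_def topspace_game_topology correlated_equilibrium_iff [OF fin]
            intro!: bexI [of _ z])
      then show False
        using U by blast
    qed
    then show "U \<in> ?N"
      using U by (simp add: topspace_game_topology)
  qed
  then show ?thesis
    using bad by (simp add: openin_diff)
qed

section \<open>Consequences of the weights\<close>

text \<open>The weighted combination is nonpositive and has expectation \<open>0\<close> under the
  stationary product, so the product puts no mass on \<open>Z\<close>, where the combination is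
  negative. The sets \<open>R i\<close> are the supports of its factors.\<close>

lemma certificate_rectangle:
  fixes S :: "nat \<Rightarrow> 's set" and y :: "nat \<times> 's \<times> 's \<Rightarrow> real"
  assumes fin: "\<forall>i\<in>{1..n}. finite (S i)" and ne: "\<forall>i\<in>{1..n}. S i \<noteq> {}"
    and y: "\<And>k. 0 \<le> y k"
    and neg: "\<And>s. s \<in> Z \<Longrightarrow> (\<Sum>k\<in>deviations n S. y k * incentive U k s) < 0"
    and zero: "\<And>s. s \<in> profiles n S - Z \<Longrightarrow> (\<Sum>k\<in>deviations n S. y k * incentive U k s) = 0"
  obtains R where "\<And>i. i \<in> {1..n} \<Longrightarrow> R i \<subseteq> S i" "\<And>i. i \<in> {1..n} \<Longrightarrow> R i \<noteq> {}"
    "\<And>i a b. \<lbrakk>i \<in> {1..n}; a \<in> R i; b \<in> S i - R i\<rbrakk> \<Longrightarrow> y (i, a, b) = 0"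
    "profiles n R \<inter> Z = {}"
proof -
  let ?A = "profiles n S" and ?w = "\<lambda>s. \<Sum>k\<in>deviations n S. y k * incentive U k s"
  obtain p where p: "\<And>i a. i \<in> {1..n} \<Longrightarrow> 0 \<le> p i a"
    "\<And>i. i \<in> {1..n} \<Longrightarrow> (\<Sum>a\<in>S i. p i a) = 1"
    "\<And>i a b. \<lbrakk>i \<in> {1..n}; a \<in> S i; b \<in> S i; p i a \<noteq> 0; y (i, a, b) \<noteq> 0\<rbrakk> \<Longrightarrow> p i b \<noteq> 0"
    "\<And>U. (\<Sum>k\<in>deviations n S. y k * incentive_sum n S U k (\<lambda>s. \<Prod>i\<in>{1..n}. p i (s i))) = 0"
    by (rule balanced_product [of n S S y]) (use fin ne y in auto)
  define x where "x s = (\<Prod>i\<in>{1..n}. p i (s i))" for s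
  have x0: "0 \<le> x s" for s
    using p(1) by (auto simp: x_def intro!: prod_nonneg)
  have w0: "?w s \<le> 0" if "s \<in> ?A" for s
    using neg [of s] zero [of s] that by force
  have "(\<Sum>s\<in>?A. ?w s * x s) = 0"
    using p(4) unfolding weighted_incentive_sum x_def .
  then have "?w s * x s = 0" if "s \<in> ?A" for s
    using sum_nonneg_eq_0_iff [of ?A "\<lambda>s. - (?w s * x s)"] finite_profiles [OF fin] w0 x0 that
    by (simp add: sum_negf mult_nonpos_nonneg)
  then have x_Z: "x s = 0" if "s \<in> ?A" "s \<in> Z" for s
    using neg that by fastforce
  show ?thesis
  proof (rule that [of "\<lambda>i. {a \<in> S i. p i a \<noteq> 0}"])
    show "{a \<in> S i. p i a \<noteq> 0} \<noteq> {}" if "i \<in> {1..n}" for i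
      using p(2) [OF that] by force
    show "y (i, a, b) = 0"
      if "i \<in> {1..n}" "a \<in> {a \<in> S i. p i a \<noteq> 0}" "b \<in> S i - {a \<in> S i. p i a \<noteq> 0}" for i a b
      using p(3) [of i a b] that by auto
    have "s \<in> ?A \<and> x s \<noteq> 0" if "s \<in> profiles n (\<lambda>i. {a \<in> S i. p i a \<noteq> 0})" for s
      using that by (auto simp: profiles_def PiE_iff x_def)
    then show "profiles n (\<lambda>i. {a \<in> S i. p i a \<noteq> 0}) \<inter> Z = {}"
      using x_Z by blast
  qed auto
qed

text \<open>A stationary product supported in the rectangle \<open>R\<close> lives off
  \<open>Z\<close>, so the combination has expectation \<open>c\<close> under it, while stationarity
  gives \<open>0\<close>.\<close>

lemma certificate_constant_zero:
  fixes S :: "nat \<Rightarrow> 's set" and y :: "nat \<times> 's \<times> 's \<Rightarrow> real"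
  assumes fin: "\<forall>i\<in>{1..n}. finite (S i)"
    and y: "\<And>k. 0 \<le> y k"
    and const: "\<And>s. s \<in> profiles n S - Z \<Longrightarrow> (\<Sum>k\<in>deviations n S. y k * incentive U k s) = c"
    and R: "\<And>i. i \<in> {1..n} \<Longrightarrow> R i \<subseteq> S i" "\<And>i. i \<in> {1..n} \<Longrightarrow> R i \<noteq> {}"
    and closed: "\<And>i a b. \<lbrakk>i \<in> {1..n}; a \<in> R i; b \<in> S i - R i\<rbrakk> \<Longrightarrow> y (i, a, b) = 0"
    and disj: "profiles n R \<inter> Z = {}"
  shows "c = 0"
proof -
  let ?A = "profiles n S" and ?w = "\<lambda>s. \<Sum>k\<in>deviations n S. y k * incentive U k s"
  obtain p where p: "\<And>i a. \<lbrakk>i \<in> {1..n}; a \<notin> R i\<rbrakk> \<Longrightarrow> p i a = 0"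
    "\<And>i. i \<in> {1..n} \<Longrightarrow> (\<Sum>a\<in>S i. p i a) = 1"
    "\<And>U. (\<Sum>k\<in>deviations n S. y k * incentive_sum n S U k (\<lambda>s. \<Prod>i\<in>{1..n}. p i (s i))) = 0"
    by (rule balanced_product [of n S R y]) (use fin R y closed in auto)
  define x where "x s = (\<Prod>i\<in>{1..n}. p i (s i))" for s
  have "x s = 0" if "s \<in> ?A" "s \<notin> profiles n R" for s
  proof -
    obtain i where "i \<in> {1..n}" "s i \<notin> R i"
      using \<open>s \<in> ?A\<close> \<open>s \<notin> profiles n R\<close> by (auto simp: profiles_def PiE_iff)
    then show ?thesis
      unfolding x_def using p(1) by (intro prod_zero bexI [of _ i]) auto
  qed
  then have "?w s * x s = c * x s" if "s \<in> ?A" for s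
    using const [of s] disj that by (cases "s \<in> profiles n R") auto
  then have "(\<Sum>s\<in>?A. ?w s * x s) = c * (\<Sum>s\<in>?A. x s)"
    unfolding sum_distrib_left by (intro sum.cong refl)
  also have "(\<Sum>s\<in>?A. x s) = 1"
    unfolding x_def using fin p(2) by (rule sum_product_profiles)
  also have "(\<Sum>s\<in>?A. ?w s * x s) = 0"
    using p(3) unfolding weighted_incentive_sum x_def .
  finally show ?thesis
    by simp
qed

text \<open>The same number is nonnegative as a combination of satisfied constraints and nonpositive
  as an expectation over profiles. Hence it is \<open>0\<close>, and so is every term of both
  sums.\<close>

lemma equilibrium_complementary_slackness:
  assumes fin: "\<forall>i\<in>{1..n}. finite (S i)"
    and y: "\<And>k. 0 \<le> y k"
    and neg: "\<And>s. s \<in> Z \<Longrightarrow> (\<Sum>k\<in>deviations n S. y k * incentive U k s) < 0"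
    and zero: "\<And>s. s \<in> profiles n S - Z \<Longrightarrow> (\<Sum>k\<in>deviations n S. y k * incentive U k s) = 0"
    and ce: "correlated_equilibrium n S U \<mu>"
  shows "set_pmf \<mu> \<subseteq> profiles n S - Z"
    and "\<And>k. \<lbrakk>k \<in> deviations n S; y k \<noteq> 0\<rbrakk> \<Longrightarrow> incentive_sum n S U k (pmf \<mu>) = 0"
proof -
  let ?A = "profiles n S" and ?w = "\<lambda>s. \<Sum>k\<in>deviations n S. y k * incentive U k s"
  have sub: "set_pmf \<mu> \<subseteq> ?A"
    and inc: "\<And>k. k \<in> deviations n S \<Longrightarrow> 0 \<le> incentive_sum n S U k (pmf \<mu>)"
    using ce by (auto simp: correlated_equilibrium_iff [OF fin])
  have nonpos: "?w s * pmf \<mu> s \<le> 0" if "s \<in> ?A" for s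
    using neg [of s] zero [of s] that by (cases "s \<in> Z") (auto simp: mult_nonpos_nonneg)
  have eq: "(\<Sum>k\<in>deviations n S. y k * incentive_sum n S U k (pmf \<mu>)) = (\<Sum>s\<in>?A. ?w s * pmf \<mu> s)"
    by (rule weighted_incentive_sum)
  have "(\<Sum>k\<in>deviations n S. y k * incentive_sum n S U k (pmf \<mu>)) \<ge> 0"
    using y inc by (intro sum_nonneg mult_nonneg_nonneg) auto
  moreover have "(\<Sum>s\<in>?A. ?w s * pmf \<mu> s) \<le> 0"
    using nonpos by (rule sum_nonpos)
  ultimately have zero_sums: "(\<Sum>k\<in>deviations n S. y k * incentive_sum n S U k (pmf \<mu>)) = 0"
    "(\<Sum>s\<in>?A. ?w s * pmf \<mu> s) = 0"
    using eq by auto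
  have "?w s * pmf \<mu> s = 0" if "s \<in> ?A" for s
    using zero_sums(2) sum_nonneg_eq_0_iff [of ?A "\<lambda>s. - (?w s * pmf \<mu> s)"]
      finite_profiles [OF fin] nonpos that by (simp add: sum_negf)
  then have "s \<notin> Z" if "s \<in> set_pmf \<mu>" for s
    using neg [of s] sub that by (force simp: set_pmf_iff)
  then show "set_pmf \<mu> \<subseteq> ?A - Z"
    using sub by blast
  fix k assume "k \<in> deviations n S" "y k \<noteq> 0"
  then show "incentive_sum n S U k (pmf \<mu>) = 0"
    using zero_sums(1) sum_nonneg_eq_0_iff [of "deviations n S" "\<lambda>k. y k * incentive_sum n S U k (pmf \<mu>)"]
      finite_deviations [OF fin] y inc by auto
qed

section \<open>The neighbourhood of a game with a unique equilibrium\<close>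

lemma unique_equilibrium_neighborhood:
  fixes S :: "nat \<Rightarrow> 's set"
  assumes fin: "\<forall>i\<in>{1..n}. finite (S i)" and ne: "\<forall>i\<in>{1..n}. S i \<noteq> {}"
    and G: "G \<in> games n S" and uniq: "unique_correlated_equilibrium n S G \<sigma>"
  shows "\<exists>N. openin (game_topology n S) N \<and> G \<in> N \<and>
    (\<forall>H\<in>N. \<exists>\<tau>. unique_correlated_equilibrium n S H \<tau> \<and> set_pmf \<tau> = set_pmf \<sigma>)"
proof -
  let ?A = "profiles n S"
  define K where "K = {k \<in> deviations n S. incentive_sum n S G k (pmf \<sigma>) = 0}"
  define Z where "Z = ?A - set_pmf \<sigma>"
  have K: "K \<subseteq> deviations n S" and Z: "Z \<subseteq> ?A"
    unfolding K_def Z_def by blast+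
  have ce: "correlated_equilibrium n S G \<sigma>" and ce_eq: "\<And>\<mu>. correlated_equilibrium n S G \<mu> \<Longrightarrow> \<mu> = \<sigma>"
    using uniq unfolding unique_correlated_equilibrium_def by blast+
  have supp: "set_pmf \<sigma> \<subseteq> ?A"
    using ce by (simp add: correlated_equilibrium_def)
  \<comment> \<open>\<open>K\<close> and \<open>Z\<close> are those of \<open>G\<close> and stay
    fixed while the game varies; this set will yield weights and uniqueness.\<close>
  define N1 where "N1 = {U \<in> games n S. \<forall>x. (\<forall>k\<in>K. 0 \<le> incentive_sum n S U k x) \<longrightarrow>
    (\<forall>s\<in>Z. 0 \<le> x s) \<longrightarrow> (\<Sum>s\<in>?A. x s) = 0 \<longrightarrow> (\<forall>s\<in>?A. x s = 0)}"
  \<comment> \<open>This set keeps the support from shrinking: equilibria must charge all of the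
    support of \<open>\<sigma>\<close>.\<close>
  define N2 where "N2 = (\<Inter>t\<in>set_pmf \<sigma>. {U \<in> games n S. \<forall>\<mu>. correlated_equilibrium n S U \<mu> \<longrightarrow> t \<in> set_pmf \<mu>})"
  have "openin (game_topology n S) N1"
    unfolding N1_def by (rule openin_only_zero_direction [OF fin K Z])
  moreover have "openin (game_topology n S) N2"
    unfolding N2_def
  proof (rule openin_INT2 [OF finite_subset [OF supp finite_profiles [OF fin]] set_pmf_not_empty])
    fix t assume "t \<in> set_pmf \<sigma>"
    then show "openin (game_topology n S)
        {U \<in> games n S. \<forall>\<mu>. correlated_equilibrium n S U \<mu> \<longrightarrow> t \<in> set_pmf \<mu>}"
      using supp by (intro openin_positive_probability fin) auto
  qed
  ultimately have "openin (game_topology n S) (N1 \<inter> N2)"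
    by (rule openin_Int)
  moreover have "G \<in> N1"
    unfolding N1_def
    using unique_equilibrium_only_zero_direction [OF fin uniq] G by (auto simp: K_def Z_def)
  moreover have "G \<in> N2"
    unfolding N2_def using G ce_eq by blast
  moreover have "\<exists>\<tau>. unique_correlated_equilibrium n S H \<tau> \<and> set_pmf \<tau> = set_pmf \<sigma>"
    if H: "H \<in> N1 \<inter> N2" for H
  proof -
    \<comment> \<open>Stated as an elimination rule because it is used for \<open>G\<close> and for
      \<open>H\<close>, with the same \<open>K\<close> and \<open>Z\<close>.\<close>
    have certificate: thesis
      if "U \<in> N1" and "\<And>y c. \<lbrakk>\<And>k. 0 \<le> y k; \<And>k. y k \<noteq> 0 \<longleftrightarrow> k \<in> K;
        \<And>s. s \<in> Z \<Longrightarrow> (\<Sum>k\<in>deviations n S. y k * incentive U k s) < c;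
        \<And>s. s \<in> ?A - Z \<Longrightarrow> (\<Sum>k\<in>deviations n S. y k * incentive U k s) = c\<rbrakk> \<Longrightarrow> thesis"
      for U thesis
    proof (rule balance_certificate [OF fin K Z, of U])
      show "x s = 0" if "\<forall>k\<in>K. 0 \<le> incentive_sum n S U k x" "\<forall>s\<in>Z. 0 \<le> x s"
        "(\<Sum>s\<in>?A. x s) = 0" "s \<in> ?A" for x s
        using \<open>U \<in> N1\<close> that by (simp add: N1_def)
    qed (rule that(2))
    obtain y c where y: "\<And>k. 0 \<le> y k" "\<And>k. y k \<noteq> 0 \<longleftrightarrow> k \<in> K"
      "\<And>s. s \<in> Z \<Longrightarrow> (\<Sum>k\<in>deviations n S. y k * incentive G k s) < c"
      "\<And>s. s \<in> ?A - Z \<Longrightarrow> (\<Sum>k\<in>deviations n S. y k * incentive G k s) = c"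
      by (rule certificate [OF \<open>G \<in> N1\<close>]) (rule that)
    \<comment> \<open>The weights sit on constraints binding at \<open>\<sigma>\<close>, and
      \<open>\<sigma>\<close> lives off \<open>Z\<close>, so evaluating the combination at
      \<open>\<sigma>\<close> gives both \<open>0\<close> and \<open>c\<close>.\<close>
    have "c = 0"
    proof -
      have "0 = (\<Sum>k\<in>deviations n S. y k * incentive_sum n S G k (pmf \<sigma>))"
        using y(2) by (intro sum.neutral [symmetric]) (auto simp: K_def)
      also have "\<dots> = (\<Sum>s\<in>?A. (\<Sum>k\<in>deviations n S. y k * incentive G k s) * pmf \<sigma> s)"
        by (rule weighted_incentive_sum)
      also have "\<dots> = (\<Sum>s\<in>?A. c * pmf \<sigma> s)"
        using y(4) by (intro sum.cong refl) (auto simp: Z_def set_pmf_iff)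
      also have "\<dots> = c"
        using sum_pmf_profiles [OF fin supp] by (simp flip: sum_distrib_left)
      finally show ?thesis ..
    qed
    obtain R where R: "\<And>i. i \<in> {1..n} \<Longrightarrow> R i \<subseteq> S i" "\<And>i. i \<in> {1..n} \<Longrightarrow> R i \<noteq> {}"
      "\<And>i a b. \<lbrakk>i \<in> {1..n}; a \<in> R i; b \<in> S i - R i\<rbrakk> \<Longrightarrow> y (i, a, b) = 0"
      "profiles n R \<inter> Z = {}"
      by (rule certificate_rectangle [of n S y Z G, OF fin ne y(1) y(3,4) [unfolded \<open>c = 0\<close>]])
        (assumption | rule that)+
    obtain y' c' where y': "\<And>k. 0 \<le> y' k" "\<And>k. y' k \<noteq> 0 \<longleftrightarrow> k \<in> K"
      "\<And>s. s \<in> Z \<Longrightarrow> (\<Sum>k\<in>deviations n S. y' k * incentive H k s) < c'"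
      "\<And>s. s \<in> ?A - Z \<Longrightarrow> (\<Sum>k\<in>deviations n S. y' k * incentive H k s) = c'"
      by (rule certificate [OF IntD1 [OF H]]) (rule that)
    \<comment> \<open>Both weight families vanish exactly off \<open>K\<close>, so the rectangle
      found for \<open>G\<close> is also closed under the transitions for \<open>H\<close>.\<close>
    have closed: "y' (i, a, b) = 0" if "i \<in> {1..n}" "a \<in> R i" "b \<in> S i - R i" for i a b
      using R(3) [OF that] y(2) y'(2) by blast
    have "c' = 0"
      by (rule certificate_constant_zero [of n S y' Z H c' R]) (fact fin y'(1,4) R(1,2,4) closed)+
    note neg = y'(3) [unfolded \<open>c' = 0\<close>] and zero = y'(4) [unfolded \<open>c' = 0\<close>]
    have supp_le: "set_pmf \<mu> \<subseteq> ?A - Z" if "correlated_equilibrium n S H \<mu>" for \<mu>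
      by (rule equilibrium_complementary_slackness(1) [of n S y' Z H]) (fact fin y'(1) neg zero that)+
    have binding: "incentive_sum n S H k (pmf \<mu>) = 0"
      if "correlated_equilibrium n S H \<mu>" "k \<in> K" for \<mu> k
    proof -
      have "k \<in> deviations n S" "y' k \<noteq> 0"
        using that(2) y'(2) K by blast+
      then show ?thesis
        by (rule equilibrium_complementary_slackness(2) [of n S y' Z H \<mu> k, rotated 5])
          (fact fin y'(1) neg zero that(1))+
    qed
    obtain \<tau> where \<tau>: "correlated_equilibrium n S H \<tau>"
      using correlated_equilibrium_exists [OF fin ne] .
    have "\<mu> = \<tau>" if \<mu>: "correlated_equilibrium n S H \<mu>" for \<mu>
    proof (rule pmf_eqI)
      fix s
      \<comment> \<open>Written with the factor \<open>-1\<close> to match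
        \<open>incentive_sum_add_scaled\<close>. Both equilibria vanish on \<open>Z\<close> and bind
        on \<open>K\<close>, so membership of \<open>H\<close> in \<open>N1\<close> forces the
        difference to be \<open>0\<close>.\<close>
      let ?d = "\<lambda>s. pmf \<mu> s + (-1) * pmf \<tau> s"
      have out: "pmf \<mu> r = 0 \<and> pmf \<tau> r = 0" if "r \<notin> ?A - Z" for r
        using supp_le [OF \<mu>] supp_le [OF \<tau>] that by (auto simp: set_pmf_iff)
      have "\<forall>k\<in>K. 0 \<le> incentive_sum n S H k ?d"
        using binding [OF \<mu>] binding [OF \<tau>] by (simp only: incentive_sum_add_scaled) simp
      moreover have "\<forall>r\<in>Z. 0 \<le> ?d r"
        using out by simp
      moreover have "(\<Sum>r\<in>?A. ?d r) = 0"
        using \<mu> \<tau> sum_pmf_profiles [OF fin]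
        by (simp add: sum_subtractf correlated_equilibrium_def)
      ultimately have "\<forall>r\<in>?A. ?d r = 0"
        using H unfolding N1_def by blast
      then show "pmf \<mu> s = pmf \<tau> s"
        using out [of s] by (cases "s \<in> ?A") auto
    qed
    then have "unique_correlated_equilibrium n S H \<tau>"
      using \<tau> unfolding unique_correlated_equilibrium_def by blast
    moreover have "set_pmf \<tau> = set_pmf \<sigma>"
    proof
      show "set_pmf \<tau> \<subseteq> set_pmf \<sigma>"
        using supp_le [OF \<tau>] unfolding Z_def by blast
      show "set_pmf \<sigma> \<subseteq> set_pmf \<tau>"
        using H \<tau> unfolding N2_def by blast
    qed
    ultimately show ?thesis
      by blast
  qed
  ultimately show ?thesis
    by (intro exI [of _ "N1 \<inter> N2"]) auto
qed

theorem proposition1: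
  fixes n :: nat and m :: "nat \<Rightarrow> nat" and S :: "nat \<Rightarrow> 's set"
  assumes "n \<ge> 1"
    and "\<forall>i\<in>{1..n}. m i \<ge> 1"
    and "\<forall>i\<in>{1..n}. finite (S i) \<and> card (S i) = m i"
  shows "openin (game_topology n S)
           {G \<in> games n S. \<exists>\<sigma>. unique_correlated_equilibrium n S G \<sigma>} \<and>
         (\<forall>G\<in>games n S. \<forall>\<sigma>. unique_correlated_equilibrium n S G \<sigma> \<longrightarrow>
           (\<exists>N. openin (game_topology n S) N \<and> G \<in> N \<and>
             (\<forall>H\<in>N. \<exists>\<tau>. unique_correlated_equilibrium n S H \<tau> \<and> set_pmf \<tau> = set_pmf \<sigma>)))"
proof -
  have fin: "\<forall>i\<in>{1..n}. finite (S i)" and ne: "\<forall>i\<in>{1..n}. S i \<noteq> {}"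
    using assms(2,3) by (auto, metis atLeastAtMost_iff card.empty not_one_le_zero One_nat_def)
  have nbhd: "\<exists>N. openin (game_topology n S) N \<and> G \<in> N \<and>
      (\<forall>H\<in>N. \<exists>\<tau>. unique_correlated_equilibrium n S H \<tau> \<and> set_pmf \<tau> = set_pmf \<sigma>)"
    if "G \<in> games n S" "unique_correlated_equilibrium n S G \<sigma>" for G \<sigma>
    using that by (rule unique_equilibrium_neighborhood [OF fin ne])
  moreover have "openin (game_topology n S)
      {G \<in> games n S. \<exists>\<sigma>. unique_correlated_equilibrium n S G \<sigma>}" (is "openin _ ?V")
  \<comment> \<open>The neighbourhood of each such game consists of such games, so the set is
    open.\<close>
  proof (subst openin_subopen, rule ballI)
    fix G assume "G \<in> ?V"
    then obtain \<sigma> where G: "G \<in> games n S" and \<sigma>: "unique_correlated_equilibrium n S G \<sigma>"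
      by blast
    obtain N where N: "openin (game_topology n S) N" "G \<in> N"
      "\<forall>H\<in>N. \<exists>\<tau>. unique_correlated_equilibrium n S H \<tau> \<and> set_pmf \<tau> = set_pmf \<sigma>"
      using nbhd [OF G \<sigma>] by blast
    then have "N \<subseteq> ?V"
      using openin_subset [OF N(1)] by (auto simp: topspace_game_topology)
    then show "\<exists>T. openin (game_topology n S) T \<and> G \<in> T \<and> T \<subseteq> ?V"
      using N by blast
  qed
  ultimately show ?thesis
    by (intro conjI ballI allI impI)
qed

end
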